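(* Let $\alpha,\beta\ge 0$ be real numbers with $\alpha+\beta>0$, let $a<b$ be real numbers, let $f:\mathbb{R}\to\mathbb{R}$ and let $p>1$. If $|f|$ is $\alpha,\beta$-symmetric integrable on $[a,b]$, then $|f|^p$ is also $\alpha,\beta$-symmetric integrable on $[a,b]$.
   Context: Let $h:\mathbb{R}\to\mathbb{R}$ and $a<b$ be reals. For $\alpha>0$, $h$ is $\alpha$-forward integrable on $[a,b]$ if the series $\alpha\sum_{k=0}^{+\infty}h(x+k\alpha)$ converges for $x=a$ and $x=b$. For $\beta>0$, $h$ is $\beta$-backward integrable on $[a,b]$ if the series $\beta\sum_{k=0}^{+\infty}h(x-k\beta)$ converges for $x=a$ and $x=b$. For $\alpha,\beta\ge 0$ with $\alpha+\beta>0$, $h$ is $\alpha,\beta$-symmetric integrable on $[a,b]$ if it is $\alpha$-forward integrable and $\beta$-backward integrable on $[a,b]$ (the forward requirement is dropped if $\alpha=0$, and the backward requirement is dropped if $\beta=0$). *)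

theory Defs
  imports Complex_Main
begin

(* The three notions are meant for forward step \<alpha> > 0, backward step \<beta> > 0, and
   \<alpha>, \<beta> \<ge> 0 with \<alpha> + \<beta> > 0, respectively.
   Integrability on [a,b] is a condition on the two endpoints only. *)

definition forward_integrable :: "real \<Rightarrow> (real \<Rightarrow> real) \<Rightarrow> real \<Rightarrow> real \<Rightarrow> bool" where
  "forward_integrable \<alpha> h a b \<longleftrightarrow>
     (\<forall>x\<in>{a, b}. summable (\<lambda>k::nat. \<alpha> * h (x + real k * \<alpha>)))"

definition backward_integrable :: "real \<Rightarrow> (real \<Rightarrow> real) \<Rightarrow> real \<Rightarrow> real \<Rightarrow> bool" where
  "backward_integrable \<beta> h a b \<longleftrightarrow>
     (\<forall>x\<in>{a, b}. summable (\<lambda>k::nat. \<beta> * h (x - real k * \<beta>)))"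

definition symmetric_integrable ::
    "real \<Rightarrow> real \<Rightarrow> (real \<Rightarrow> real) \<Rightarrow> real \<Rightarrow> real \<Rightarrow> bool" where
  "symmetric_integrable \<alpha> \<beta> h a b \<longleftrightarrow>
     (\<alpha> \<noteq> 0 \<longrightarrow> forward_integrable \<alpha> h a b) \<and>
     (\<beta> \<noteq> 0 \<longrightarrow> backward_integrable \<beta> h a b)"

end

theory Submission
  imports Defs
begin

text \<open>
  Integrability here is convergence of series of nonnegative terms sampled along arithmetic
  progressions, so everything rests on one inclusion of sequence spaces: an absolutely summable
  sequence is \<open>p\<close>-th power summable for every \<open>p \<ge> 1\<close>
  (\<open>summable_abs_powr\<close>). The terms of a convergent series tend to zero, so they
  eventually lie in \<open>[0, 1]\<close>, where raising to a power \<open>p \<ge> 1\<close> can only decrease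
  a number; the comparison test does the rest. Applied to each of the progressions leaving \<open>a\<close>
  and \<open>b\<close>, this gives the theorem. The step size multiplying the terms is a nonzero constant
  and cancels.
\<close>

lemma summable_abs_powr:
  fixes u :: "nat \<Rightarrow> real"
  assumes "summable (\<lambda>k. \<bar>u k\<bar>)" and "p \<ge> 1"
  shows "summable (\<lambda>k. \<bar>u k\<bar> powr p)"
proof (rule summable_comparison_test_ev)
  have "\<forall>\<^sub>F k in sequentially. \<bar>u k\<bar> < 1"
    using summable_LIMSEQ_zero[OF assms(1)] by (rule order_tendstoD) simp
  then show "\<forall>\<^sub>F k in sequentially. norm (\<bar>u k\<bar> powr p) \<le> \<bar>u k\<bar>"
  proof eventually_elim
    case (elim k)
    then show ?case
      using powr_mono'[of 1 p "\<bar>u k\<bar>"] assms(2) by simp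
  qed
qed (fact assms(1))

theorem theorem7:
  fixes \<alpha> \<beta> a b p :: real and f :: "real \<Rightarrow> real"
  assumes "\<alpha> \<ge> 0" and "\<beta> \<ge> 0" and "\<alpha> + \<beta> > 0"
    and "a < b"
    and "p > 1"
    and "symmetric_integrable \<alpha> \<beta> (\<lambda>x. \<bar>f x\<bar>) a b"
  shows "symmetric_integrable \<alpha> \<beta> (\<lambda>x. \<bar>f x\<bar> powr p) a b"
  using assms(5,6)
  unfolding symmetric_integrable_def forward_integrable_def backward_integrable_def
  by (auto simp: summable_cmult_iff intro!: summable_abs_powr)

end
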